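(* Let $\mathcal I$ be an ideal on $\mathbb N$. (1) If $\mathcal I^+\cap \mathcal I_{1/n}\neq\emptyset$ and $\mathcal I^*\cap \mathcal I_{1/n}=\emptyset$, then $AOS(\mathcal I)\not\subseteq AOS(\mathcal I^+)$ and $AOS(\mathcal I^* )\not\subseteq AOS(\mathcal I^+)$. (2) Every ideal $\mathcal I$ on $\mathbb N$ which is strictly contained in $\mathcal I_{1/n}$ (e.g. the ideal $\mathcal I=\mathrm{Fin}$ of all finite subsets of $\mathbb N$) satisfies $\mathcal I^+\cap \mathcal I_{1/n}\neq\emptyset$ and $\mathcal I^*\cap \mathcal I_{1/n}=\emptyset$. (3) If $\mathcal I$ is not a weak P-ideal and $\mathcal I^*\cap \mathcal I_{1/n}\neq \emptyset$, then $AOS(\mathcal I^+)\not\subseteq AOS(\mathcal I)$. (4) If $\mathcal I$ is not a P-ideal and $\mathcal I^*\cap \mathcal I_{1/n}\neq \emptyset$, then $AOS(\mathcal I^* )\not\subseteq AOS(\mathcal I)$. (5) There exists an ideal $\mathcal I$ on $\mathbb N$ which is not a weak P-ideal, is not a P-ideal, and satisfies $\mathcal I^*\cap \mathcal I_{1/n}\neq \emptyset$.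
   Context: $\mathbb N=\{1,2,\dots\}$. An ideal on $\mathbb N$ is a nonempty family $\mathcal I\subseteq\mathcal P(\mathbb N)$ closed under subsets and finite unions, containing all finite subsets of $\mathbb N$, with $\mathbb N\notin\mathcal I$. $\mathcal I^*=\{\mathbb N\setminus A: A\in\mathcal I\}$ is the dual filter and $\mathcal I^+=\{A\subseteq\mathbb N:A\notin\mathcal I\}$ is the coideal. $\mathcal I_{1/n}=\{A\subseteq\mathbb N:\sum_{n\in A}\frac1n<\infty\}$ is the summable ideal. An ideal $\mathcal I$ is a P-ideal (resp. a weak P-ideal) if for each countable family $\mathcal A\subseteq\mathcal I$ there exists $B\in\mathcal I^*$ (resp. $B\in\mathcal I^+$) such that $B\cap A$ is finite for each $A\in\mathcal A$. For a real sequence $(x_n)$: $(x_n)$ is $\mathcal I$-convergent to $0$ if $\{n:|x_n|\ge\varepsilon\}\in\mathcal I$ for every $\varepsilon>0$; it is $\mathcal I^*$-convergent (resp. $\mathcal I^+$-convergent) to $0$ if there is $F\in\mathcal I^*$ (resp. $F\in\mathcal I^+$) such that the subsequence $(x_n)_{n\in F}$ converges to $0$ in the ordinary sense. $\ell_1$ is the space of real sequences with absolutely convergent series. $AOS(\mathcal I)$ (resp. $AOS(\mathcal I^* )$, $AOS(\mathcal I^+)$) is the set of all $(a_n)\in\ell_1$ such that $(na_n)$ is not $\mathcal I$-convergent (resp. not $\mathcal I^*$-convergent, not $\mathcal I^+$-convergent) to zero. *)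

theory Defs
  imports "HOL-Analysis.Analysis"
begin

(* The paper's set of natural numbers is {1,2,...}; it is kept as a carrier inside the type nat. *)
abbreviation NN :: "nat set" where
  "NN \<equiv> {1..}"

definition is_ideal :: "nat set set \<Rightarrow> bool" where
  "is_ideal I \<longleftrightarrow>
     I \<noteq> {} \<and> I \<subseteq> Pow NN \<and>
     (\<forall>A\<in>I. \<forall>B. B \<subseteq> A \<longrightarrow> B \<in> I) \<and>
     (\<forall>A\<in>I. \<forall>B\<in>I. A \<union> B \<in> I) \<and>
     (\<forall>A. A \<subseteq> NN \<and> finite A \<longrightarrow> A \<in> I) \<and>
     NN \<notin> I"

definition dual_filter :: "nat set set \<Rightarrow> nat set set" where
  "dual_filter I = {NN - A | A. A \<in> I}"

definition coideal :: "nat set set \<Rightarrow> nat set set" where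
  "coideal I = {A. A \<subseteq> NN \<and> A \<notin> I}"

definition Fin :: "nat set set" where
  "Fin = {A. A \<subseteq> NN \<and> finite A}"

(* The terms are nonnegative, so unordered summability is finiteness of the sum. *)
definition summable_ideal :: "nat set set" where
  "summable_ideal = {A. A \<subseteq> NN \<and> (\<lambda>n. 1 / real n) summable_on A}"

definition P_ideal :: "nat set set \<Rightarrow> bool" where
  "P_ideal I \<longleftrightarrow> is_ideal I \<and>
     (\<forall>\<A>. \<A> \<subseteq> I \<and> countable \<A> \<longrightarrow> (\<exists>B\<in>dual_filter I. \<forall>A\<in>\<A>. finite (B \<inter> A)))"

definition weak_P_ideal :: "nat set set \<Rightarrow> bool" where
  "weak_P_ideal I \<longleftrightarrow> is_ideal I \<and>
     (\<forall>\<A>. \<A> \<subseteq> I \<and> countable \<A> \<longrightarrow> (\<exists>B\<in>coideal I. \<forall>A\<in>\<A>. finite (B \<inter> A)))"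

definition ideal_null :: "nat set set \<Rightarrow> (nat \<Rightarrow> real) \<Rightarrow> bool" where
  "ideal_null I x \<longleftrightarrow> (\<forall>\<epsilon>>0. {n\<in>NN. \<bar>x n\<bar> \<ge> \<epsilon>} \<in> I)"

(* For an ideal I, the members of dual_filter I and of coideal I are infinite, so that
   enumerate F lists F increasingly and x (enumerate F k) is the subsequence along F.
   Convergence to zero in the starred (plus) sense is null_along (dual_filter I)
   (null_along (coideal I)). *)
definition null_along :: "nat set set \<Rightarrow> (nat \<Rightarrow> real) \<Rightarrow> bool" where
  "null_along \<F> x \<longleftrightarrow> (\<exists>F\<in>\<F>. (\<lambda>k. x (enumerate F k)) \<longlonglongrightarrow> 0)"

(* Sequences indexed by NN are functions on nat; the value at 0, which is not an index,
   is pinned so that every sequence has exactly one representative. *)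
definition ell1 :: "(nat \<Rightarrow> real) set" where
  "ell1 = {a. a 0 = 0 \<and> (\<lambda>n. \<bar>a n\<bar>) summable_on NN}"

definition AOS :: "nat set set \<Rightarrow> (nat \<Rightarrow> real) set" where
  "AOS I = {a \<in> ell1. \<not> ideal_null I (\<lambda>n. real n * a n)}"

definition AOS_star :: "nat set set \<Rightarrow> (nat \<Rightarrow> real) set" where
  "AOS_star I = {a \<in> ell1. \<not> null_along (dual_filter I) (\<lambda>n. real n * a n)}"

definition AOS_plus :: "nat set set \<Rightarrow> (nat \<Rightarrow> real) set" where
  "AOS_plus I = {a \<in> ell1. \<not> null_along (coideal I) (\<lambda>n. real n * a n)}"

end

theory Submission
  imports Defs
begin

text \<open>
  All the counterexamples have the form \<open>a_n = x_n / n\<close> with \<open>0 \<le> x_n \<le> 1\<close> and \<open>x\<close> supported on a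
  set of the summable ideal, so that \<open>a\<close> lies in \<open>\<ell>\<^sub>1\<close>. For (1), \<open>x\<close> is the indicator of a summable
  positive set, whose complement is again positive. For (3) and (4), let \<open>A_0, A_1, \<dots>\<close> witness the
  failure of the (weak) P-property and let \<open>S\<close> be a summable set of the dual filter; take
  \<open>x_n = 1 / (k + 1)\<close> for \<open>n \<in> S\<close>, where \<open>k\<close> is least with \<open>n \<in> A_k\<close>: a set along which \<open>x\<close> tends
  to zero would meet every \<open>S \<inter> A_k\<close> in a finite set. For (5), the ideal \<open>Fin \<otimes> Fin\<close> is transported
  to the powers of two.
\<close>

section \<open>Ideals, dual filters and coideals\<close>

lemma ideal_subset: "is_ideal I \<Longrightarrow> A \<in> I \<Longrightarrow> B \<subseteq> A \<Longrightarrow> B \<in> I"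
  unfolding is_ideal_def by blast

lemma ideal_Un: "is_ideal I \<Longrightarrow> A \<in> I \<Longrightarrow> B \<in> I \<Longrightarrow> A \<union> B \<in> I"
  unfolding is_ideal_def by blast

lemma ideal_finite: "is_ideal I \<Longrightarrow> A \<subseteq> NN \<Longrightarrow> finite A \<Longrightarrow> A \<in> I"
  unfolding is_ideal_def by blast

lemma ideal_carrier: "is_ideal I \<Longrightarrow> A \<in> I \<Longrightarrow> A \<subseteq> NN"
  unfolding is_ideal_def by blast

lemma NN_notin_ideal: "is_ideal I \<Longrightarrow> NN \<notin> I"
  unfolding is_ideal_def by blast

lemma ideal_UN_finite:
  assumes "is_ideal I" "finite K" "\<And>k. k \<in> K \<Longrightarrow> A k \<in> I"
  shows "(\<Union>k\<in>K. A k) \<in> I"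
  using assms(2,3)
  by (induction K) (auto intro: ideal_Un[OF assms(1)] ideal_finite[OF assms(1)])

lemma dual_filter_iff:
  assumes "is_ideal I"
  shows "F \<in> dual_filter I \<longleftrightarrow> F \<subseteq> NN \<and> NN - F \<in> I"
proof
  assume "F \<in> dual_filter I"
  then obtain A where "A \<in> I" "F = NN - A"
    unfolding dual_filter_def by blast
  moreover have "NN - (NN - A) = A"
    using ideal_carrier[OF assms \<open>A \<in> I\<close>] by blast
  ultimately show "F \<subseteq> NN \<and> NN - F \<in> I" by auto
next
  assume F: "F \<subseteq> NN \<and> NN - F \<in> I"
  then have "F = NN - (NN - F)" by blast
  then show "F \<in> dual_filter I"
    unfolding dual_filter_def using F by blast
qed

lemma dual_filter_subset_coideal:
  assumes "is_ideal I"
  shows "dual_filter I \<subseteq> coideal I"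
proof
  fix F assume F: "F \<in> dual_filter I"
  have "F \<notin> I"
  proof
    assume "F \<in> I"
    then have "F \<union> (NN - F) \<in> I"
      using F ideal_Un[OF assms] dual_filter_iff[OF assms] by blast
    moreover have "F \<union> (NN - F) = NN"
      using F dual_filter_iff[OF assms] by blast
    ultimately show False
      using NN_notin_ideal[OF assms] by simp
  qed
  then show "F \<in> coideal I"
    using F dual_filter_iff[OF assms] unfolding coideal_def by blast
qed

lemma coideal_infinite: "is_ideal I \<Longrightarrow> F \<in> coideal I \<Longrightarrow> infinite F"
  unfolding coideal_def using ideal_finite by blast

lemma dual_filter_Int:
  assumes "is_ideal I" "F \<in> dual_filter I" "S \<in> dual_filter I"
  shows "F \<inter> S \<in> dual_filter I"
proof -
  have "NN - F \<inter> S = (NN - F) \<union> (NN - S)" by blast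
  then show ?thesis
    using assms(2,3) ideal_Un[OF assms(1)] unfolding dual_filter_iff[OF assms(1)] by auto
qed

text \<open>Otherwise \<open>F\<close> would be covered by two members of \<open>I\<close>, namely
  \<open>F \<inter> S\<close> and \<open>NN - S\<close>.\<close>

lemma coideal_Int_dual_filter:
  assumes "is_ideal I" "F \<in> coideal I" "S \<in> dual_filter I"
  shows "F \<inter> S \<in> coideal I"
proof -
  have "F \<inter> S \<notin> I"
  proof
    assume "F \<inter> S \<in> I"
    then have "(F \<inter> S) \<union> (NN - S) \<in> I"
      using assms(3) ideal_Un[OF assms(1)] unfolding dual_filter_iff[OF assms(1)] by blast
    moreover have "F \<subseteq> (F \<inter> S) \<union> (NN - S)"
      using assms(2) unfolding coideal_def by blast
    ultimately show False
      using assms(2) ideal_subset[OF assms(1)] unfolding coideal_def by blast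
  qed
  then show ?thesis
    using assms(2) unfolding coideal_def by blast
qed

text \<open>Every member of the dual filter is positive, so the same \<open>B\<close> serves. In (5)
  it is therefore enough to refute the weak property.\<close>

lemma weak_P_ideal_if_P_ideal: "P_ideal I \<Longrightarrow> weak_P_ideal I"
  unfolding P_ideal_def weak_P_ideal_def
  by (metis dual_filter_subset_coideal subsetD)

section \<open>Null subsequences and weighted sequences in \<open>ell1\<close>\<close>

lemma finite_ge_if_subseq_tendsto_0:
  fixes x :: "nat \<Rightarrow> real"
  assumes "infinite F" "(\<lambda>k. x (enumerate F k)) \<longlonglongrightarrow> 0" "\<epsilon> > 0"
  shows "finite {n \<in> F. \<epsilon> \<le> \<bar>x n\<bar>}"
proof -
  obtain K where K: "\<And>k. k \<ge> K \<Longrightarrow> \<bar>x (enumerate F k)\<bar> < \<epsilon>"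
    using LIMSEQ_D[OF assms(2,3)] by auto
  \<comment> \<open>Each index in \<open>F\<close> is some \<open>enumerate F k\<close>, and a value
    of size at least \<open>\<epsilon>\<close> forces \<open>k < K\<close>. From here on convergence
    along \<open>F\<close> is used only through finiteness of such level sets.\<close>
  have "{n \<in> F. \<epsilon> \<le> \<bar>x n\<bar>} \<subseteq> enumerate F ` {..<K}"
  proof
    fix n assume n: "n \<in> {n \<in> F. \<epsilon> \<le> \<bar>x n\<bar>}"
    then obtain k where "n = enumerate F k"
      using range_enumerate[OF assms(1)] by blast
    with n K[of k] show "n \<in> enumerate F ` {..<K}"
      by (cases "k < K") auto
  qed
  then show ?thesis
    using finite_subset by blast
qed

lemma null_along_if_zero:
  assumes "F \<in> \<F>" "infinite F" "\<And>n. n \<in> F \<Longrightarrow> x n = 0"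
  shows "null_along \<F> x"
proof -
  have "(\<lambda>k. x (enumerate F k)) = (\<lambda>_. 0)"
    using assms(3) enumerate_in_set[OF assms(2)] by blast
  then show ?thesis
    unfolding null_along_def by (intro bexI[OF _ assms(1)]) simp
qed

lemma weighted_in_ell1:
  fixes x :: "nat \<Rightarrow> real"
  assumes S: "S \<in> summable_ideal"
    and x: "\<And>n. \<bar>x n\<bar> \<le> 1" "\<And>n. n \<notin> S \<Longrightarrow> x n = 0"
  shows "(\<lambda>n. x n / real n) \<in> ell1"
proof -
  have "(\<lambda>n. \<bar>x n / real n\<bar>) summable_on S"
  proof (rule summable_on_comparison_test)
    show "(\<lambda>n. 1 / real n) summable_on S"
      using S unfolding summable_ideal_def by simp
    show "\<bar>x n / real n\<bar> \<le> 1 / real n" for n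
      using x(1)[of n] by (simp add: divide_right_mono)
  qed auto
  moreover have "(\<lambda>n. \<bar>x n / real n\<bar>) summable_on NN \<longleftrightarrow> (\<lambda>n. \<bar>x n / real n\<bar>) summable_on S"
    using S x(2) unfolding summable_ideal_def by (intro summable_on_cong_neutral) auto
  \<comment> \<open>The pinned value at index 0 comes for free, since division by zero yields
    0.\<close>
  ultimately show ?thesis
    unfolding ell1_def by simp
qed

lemma unweight:
  fixes x :: "nat \<Rightarrow> real"
  assumes "S \<in> summable_ideal" "\<And>n. n \<notin> S \<Longrightarrow> x n = 0"
  shows "(\<lambda>n. real n * (x n / real n)) = x"
proof
  fix n
  show "real n * (x n / real n) = x n"
    \<comment> \<open>At \<open>n = 0\<close> the left side is 0, and so is \<open>x 0\<close>,
      because \<open>S \<subseteq> NN\<close> excludes 0.\<close>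
    using assms unfolding summable_ideal_def by (cases "n = 0") auto
qed

section \<open>Counterexamples to the inclusions between the AOS sets\<close>

lemma positive_summable_set_counterexample:
  assumes I: "is_ideal I"
    and A: "A \<in> coideal I" "A \<in> summable_ideal"
    and no_dual: "dual_filter I \<inter> summable_ideal = {}"
  shows "\<not> AOS I \<subseteq> AOS_plus I \<and> \<not> AOS_star I \<subseteq> AOS_plus I"
proof -
  define x :: "nat \<Rightarrow> real" where "x n = (if n \<in> A then 1 else 0)" for n
  define a where "a n = x n / real n" for n
  have supp: "\<And>n. n \<notin> A \<Longrightarrow> x n = 0"
    by (simp add: x_def)
  have a: "a \<in> ell1" "(\<lambda>n. real n * a n) = x"
    unfolding a_def using weighted_in_ell1[OF A(2), of x] unweight[OF A(2), of x] supp
    by (auto simp: x_def)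
  have ANN: "A \<subseteq> NN" "A \<notin> I"
    using A(1) unfolding coideal_def by auto
  \<comment> \<open>If the complement were in \<open>I\<close>, then \<open>A\<close> would be a
    summable member of the dual filter.\<close>
  have "NN - A \<notin> I"
    using no_dual A(2) ANN(1) unfolding dual_filter_iff[OF I] disjoint_iff by blast
  then have compl: "NN - A \<in> coideal I"
    unfolding coideal_def by blast
  have "null_along (coideal I) x"
    by (rule null_along_if_zero[OF compl coideal_infinite[OF I compl]]) (simp add: x_def)
  then have "a \<notin> AOS_plus I"
    unfolding AOS_plus_def by (simp add: a)
  moreover have "\<not> ideal_null I x"
  proof
    assume "ideal_null I x"
    then have "{n \<in> NN. \<bar>x n\<bar> \<ge> 1} \<in> I"
      unfolding ideal_null_def by simp
    moreover have "{n \<in> NN. \<bar>x n\<bar> \<ge> 1} = A"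
      using ANN(1) by (auto simp: x_def)
    ultimately show False
      using ANN(2) by simp
  qed
  moreover have "\<not> null_along (dual_filter I) x"
  proof
    assume "null_along (dual_filter I) x"
    then obtain F where F: "F \<in> dual_filter I" "(\<lambda>k. x (enumerate F k)) \<longlonglongrightarrow> 0"
      unfolding null_along_def by blast
    \<comment> \<open>As \<open>A\<close> is positive and \<open>F\<close> is in the dual filter,
      \<open>A \<inter> F\<close> is positive, hence infinite, and \<open>x\<close> equals 1 on
      it.\<close>
    have "F \<in> coideal I"
      using F(1) dual_filter_subset_coideal[OF I] by blast
    then have "finite {n \<in> F. 1 \<le> \<bar>x n\<bar>}"
      using finite_ge_if_subseq_tendsto_0[OF coideal_infinite[OF I] F(2)] by simp
    moreover have "{n \<in> F. 1 \<le> \<bar>x n\<bar>} = A \<inter> F"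
      by (auto simp: x_def)
    moreover have "infinite (A \<inter> F)"
      using coideal_infinite[OF I coideal_Int_dual_filter[OF I A(1) F(1)]] .
    ultimately show False by simp
  qed
  ultimately show ?thesis
    using a unfolding AOS_def AOS_star_def by auto
qed

text \<open>The family \<open>\<G>\<close> stands for either \<open>coideal I\<close> or
  \<open>dual_filter I\<close>, so one construction handles the failure of both P-properties.
  Closure under intersection with \<open>S\<close> lets the failure be applied inside
  \<open>S\<close>, where \<open>x\<close> is not cut off to 0.\<close>

lemma failing_P_property_counterexample:
  assumes I: "is_ideal I"
    and S: "S \<in> summable_ideal"
    and \<G>: "\<G> \<noteq> {}" "\<And>F. F \<in> \<G> \<Longrightarrow> infinite F" "\<And>F. F \<in> \<G> \<Longrightarrow> F \<inter> S \<in> \<G>"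
    and \<A>: "\<A> \<subseteq> I" "countable \<A>" "\<And>B. B \<in> \<G> \<Longrightarrow> \<exists>A\<in>\<A>. infinite (B \<inter> A)"
  obtains a where "a \<in> ell1" "ideal_null I (\<lambda>n. real n * a n)"
    "\<not> null_along \<G> (\<lambda>n. real n * a n)"
proof -
  \<comment> \<open>Nonemptiness lets \<open>from_nat_into\<close> list exactly the members of
    \<open>\<A>\<close>, possibly with repetitions.\<close>
  have "\<A> \<noteq> {}"
    using \<G>(1) \<A>(3) by blast
  define A where "A = from_nat_into \<A>"
  have rangeA: "range A = \<A>"
    unfolding A_def using range_from_nat_into[OF \<open>\<A> \<noteq> {}\<close> \<A>(2)] .
  define k where "k n = (LEAST k. n \<in> A k)" for n
  define x :: "nat \<Rightarrow> real"
    where "x n = (if n \<in> S \<inter> (\<Union>j. A j) then 1 / real (Suc (k n)) else 0)" for n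
  define a where "a n = x n / real n" for n
  have supp: "\<And>n. n \<notin> S \<Longrightarrow> x n = 0"
    by (simp add: x_def)
  have bound: "\<bar>x n\<bar> \<le> 1" for n
    by (simp add: x_def)
  have a: "a \<in> ell1" "(\<lambda>n. real n * a n) = x"
    unfolding a_def using weighted_in_ell1[OF S bound supp] unweight[OF S supp] by auto
  \<comment> \<open>The least index is at most any index \<open>j\<close> with
    \<open>n \<in> A j\<close>, so \<open>x\<close> stays away from 0 on each
    \<open>S \<inter> A j\<close>, even if the sets overlap.\<close>
  have lower: "1 / real (Suc j) \<le> x n" if "n \<in> S" "n \<in> A j" for n j
  proof -
    have "k n \<le> j"
      unfolding k_def using that(2) by (rule Least_le)
    moreover have "x n = 1 / real (Suc (k n))"
      using that by (auto simp: x_def)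
    ultimately show ?thesis
      by (simp add: frac_le)
  qed
  have "ideal_null I x"
    unfolding ideal_null_def
  proof (intro allI impI)
    fix \<epsilon> :: real assume "\<epsilon> > 0"
    then obtain K where K: "1 / real (Suc K) < \<epsilon>"
      using nat_approx_posE by metis
    \<comment> \<open>A value at least \<open>\<epsilon> > 1 / (K + 1)\<close> forces
      \<open>k n < K\<close>, so finitely many of the \<open>A j\<close> cover the level
      set.\<close>
    have "{n \<in> NN. \<bar>x n\<bar> \<ge> \<epsilon>} \<subseteq> (\<Union>j\<in>{..<K}. A j)"
    proof
      fix n assume n: "n \<in> {n \<in> NN. \<bar>x n\<bar> \<ge> \<epsilon>}"
      then have "x n \<noteq> 0" using \<open>\<epsilon> > 0\<close> by auto
      then have "n \<in> S \<inter> (\<Union>j. A j)"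
        unfolding x_def by presburger
      then obtain j where "n \<in> A j" and xn: "x n = 1 / real (Suc (k n))"
        unfolding x_def by auto
      then have "n \<in> A (k n)"
        unfolding k_def by (auto intro: LeastI)
      moreover have "k n < K"
      proof (rule ccontr)
        assume "\<not> k n < K"
        then have "1 / real (Suc (k n)) \<le> 1 / real (Suc K)"
          by (simp add: frac_le)
        with n xn K show False by simp
      qed
      ultimately show "n \<in> (\<Union>j\<in>{..<K}. A j)" by blast
    qed
    moreover have "(\<Union>j\<in>{..<K}. A j) \<in> I"
      using rangeA \<A>(1) by (intro ideal_UN_finite[OF I]) auto
    ultimately show "{n \<in> NN. \<bar>x n\<bar> \<ge> \<epsilon>} \<in> I"
      using ideal_subset[OF I] by blast
  qed
  moreover have "\<not> null_along \<G> x"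
  proof
    assume "null_along \<G> x"
    then obtain F where F: "F \<in> \<G>" "(\<lambda>k. x (enumerate F k)) \<longlonglongrightarrow> 0"
      unfolding null_along_def by blast
    \<comment> \<open>The failure of the P-property is applied to \<open>F \<inter> S\<close> rather
      than to \<open>F\<close>; on the resulting infinite set \<open>x\<close> is at least
      \<open>1 / (j + 1)\<close>.\<close>
    obtain j where j: "infinite (F \<inter> S \<inter> A j)"
      using \<A>(3)[OF \<G>(3)[OF F(1)]] rangeA by blast
    have "finite {n \<in> F. 1 / real (Suc j) \<le> \<bar>x n\<bar>}"
      by (rule finite_ge_if_subseq_tendsto_0[OF \<G>(2)[OF F(1)] F(2)]) simp
    moreover have "F \<inter> S \<inter> A j \<subseteq> {n \<in> F. 1 / real (Suc j) \<le> \<bar>x n\<bar>}"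
      using lower[of _ j] by fastforce
    ultimately show False
      using j finite_subset by blast
  qed
  ultimately show thesis
    using that[OF a(1)] unfolding a(2) by blast
qed

lemma not_weak_P_ideal_counterexample:
  assumes I: "is_ideal I" and "\<not> weak_P_ideal I"
    and S: "S \<in> dual_filter I" "S \<in> summable_ideal"
  shows "\<not> AOS_plus I \<subseteq> AOS I"
proof -
  have "\<exists>\<A>. \<A> \<subseteq> I \<and> countable \<A> \<and> (\<forall>B\<in>coideal I. \<exists>A\<in>\<A>. infinite (B \<inter> A))"
    using assms(1,2) unfolding weak_P_ideal_def by simp
  then obtain \<A> where \<A>: "\<A> \<subseteq> I" "countable \<A>" "\<And>B. B \<in> coideal I \<Longrightarrow> \<exists>A\<in>\<A>. infinite (B \<inter> A)"
    by auto
  have "coideal I \<noteq> {}"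
    using S(1) dual_filter_subset_coideal[OF I] by blast
  from failing_P_property_counterexample[OF I S(2) this coideal_infinite[OF I]
      coideal_Int_dual_filter[OF I _ S(1)] \<A>]
  obtain a where "a \<in> ell1" "ideal_null I (\<lambda>n. real n * a n)"
    "\<not> null_along (coideal I) (\<lambda>n. real n * a n)" .
  then show ?thesis
    unfolding AOS_def AOS_plus_def by blast
qed

lemma not_P_ideal_counterexample:
  assumes I: "is_ideal I" and "\<not> P_ideal I"
    and S: "S \<in> dual_filter I" "S \<in> summable_ideal"
  shows "\<not> AOS_star I \<subseteq> AOS I"
proof -
  have "\<exists>\<A>. \<A> \<subseteq> I \<and> countable \<A> \<and> (\<forall>B\<in>dual_filter I. \<exists>A\<in>\<A>. infinite (B \<inter> A))"
    using assms(1,2) unfolding P_ideal_def by simp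
  then obtain \<A> where \<A>: "\<A> \<subseteq> I" "countable \<A>" "\<And>B. B \<in> dual_filter I \<Longrightarrow> \<exists>A\<in>\<A>. infinite (B \<inter> A)"
    by auto
  have ne: "dual_filter I \<noteq> {}"
    using S(1) by blast
  have inf: "infinite F" if "F \<in> dual_filter I" for F
    using that coideal_infinite[OF I] dual_filter_subset_coideal[OF I] by blast
  from failing_P_property_counterexample[OF I S(2) ne inf dual_filter_Int[OF I _ S(1)] \<A>]
  obtain a where "a \<in> ell1" "ideal_null I (\<lambda>n. real n * a n)"
    "\<not> null_along (dual_filter I) (\<lambda>n. real n * a n)" .
  then show ?thesis
    unfolding AOS_def AOS_star_def by blast
qed

section \<open>The summable ideal and its proper subideals\<close>

lemma powers_of_two_summable: "range (\<lambda>k. 2 ^ k) \<in> summable_ideal"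
proof -
  \<comment> \<open>Along the powers of two the reciprocals form a geometric series of ratio
    1/2.\<close>
  have "(\<lambda>k. (1 / 2) ^ k :: real) summable_on UNIV"
    by (subst summable_on_UNIV_nonneg_real_iff) (auto intro: summable_geometric)
  moreover have "(\<lambda>n. 1 / real n) \<circ> (\<lambda>k. 2 ^ k) = (\<lambda>k. (1 / 2) ^ k)"
    by (auto simp: power_one_over)
  ultimately have "(\<lambda>n. 1 / real n) summable_on range (\<lambda>k. 2 ^ k)"
    by (subst summable_on_reindex) (auto intro: injI)
  then show ?thesis
    unfolding summable_ideal_def by auto
qed

lemma NN_not_summable: "NN \<notin> summable_ideal"
proof
  assume "NN \<in> summable_ideal"
  then have "(\<lambda>n. 1 / real n) summable_on NN"
    unfolding summable_ideal_def by simp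
  \<comment> \<open>Index 0 contributes \<open>1 / real 0 = 0\<close>, so adding it leaves the
    harmonic series unchanged.\<close>
  moreover have "(\<lambda>n. 1 / real n) summable_on NN \<longleftrightarrow> (\<lambda>n. 1 / real n) summable_on UNIV"
    by (intro summable_on_cong_neutral) auto
  ultimately have "summable (\<lambda>n. 1 / real n)"
    by (simp add: summable_on_UNIV_nonneg_real_iff)
  then show False
    using not_summable_harmonic[where 'a = real] by (simp add: inverse_eq_divide)
qed

text \<open>A summable set outside \<open>J\<close> is positive. A summable member of the dual
  filter would have its complement in \<open>J\<close>, hence summable too, and the harmonic series
  would converge.\<close>

lemma proper_subideal_of_summable:
  assumes J: "is_ideal J" "J \<subset> summable_ideal"
  shows "coideal J \<inter> summable_ideal \<noteq> {} \<and> dual_filter J \<inter> summable_ideal = {}"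
proof
  obtain B where "B \<in> summable_ideal" "B \<notin> J"
    using J(2) by blast
  then show "coideal J \<inter> summable_ideal \<noteq> {}"
    unfolding coideal_def summable_ideal_def by blast
  show "dual_filter J \<inter> summable_ideal = {}"
  proof (rule ccontr)
    assume "dual_filter J \<inter> summable_ideal \<noteq> {}"
    then obtain F where F: "F \<in> dual_filter J" "F \<in> summable_ideal"
      by blast
    have "F \<subseteq> NN" and "NN - F \<in> summable_ideal"
      using F(1) J(2) unfolding dual_filter_iff[OF J(1)] by auto
    then have "(\<lambda>n. 1 / real n) summable_on F \<union> (NN - F)"
      using F(2) unfolding summable_ideal_def by (intro summable_on_Un_disjoint) auto
    moreover have "F \<union> (NN - F) = NN"
      using \<open>F \<subseteq> NN\<close> by blast
    ultimately show False
      using NN_not_summable unfolding summable_ideal_def by simp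
  qed
qed

lemma is_ideal_Fin: "is_ideal Fin"
  unfolding is_ideal_def Fin_def by (auto intro: finite_subset simp: infinite_Ici)

lemma Fin_psubset_summable_ideal: "Fin \<subset> summable_ideal"
proof
  show "Fin \<subseteq> summable_ideal"
    unfolding Fin_def summable_ideal_def by auto
  have "infinite (range (\<lambda>k. 2 ^ k :: nat))"
    by (intro range_inj_infinite injI) simp
  then show "Fin \<noteq> summable_ideal"
    using powers_of_two_summable unfolding Fin_def by blast
qed

section \<open>The ideal \<open>Fin \<otimes> Fin\<close> carried by the powers of two\<close>

definition pow2_pair :: "nat \<Rightarrow> nat \<Rightarrow> nat" where
  "pow2_pair k m = 2 ^ prod_encode (k, m)"

text \<open>The number \<open>pow2_pair k m\<close> plays the role of the point
  \<open>(k, m)\<close>, and \<open>range (pow2_pair k)\<close> that of column \<open>k\<close>: all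
  but finitely many columns meet \<open>A\<close> in a finite set. Numbers that are not powers of
  two are unconstrained.\<close>

definition Fin_times_Fin :: "nat set set" where
  "Fin_times_Fin = {A. A \<subseteq> NN \<and> (\<forall>\<^sub>F k in sequentially. finite {m. pow2_pair k m \<in> A})}"

lemma pow2_pair_eq_iff [simp]: "pow2_pair k m = pow2_pair k' m' \<longleftrightarrow> k = k' \<and> m = m'"
  by (simp add: pow2_pair_def)

lemma pow2_pair_ge_1 [simp]: "Suc 0 \<le> pow2_pair k m"
  by (simp add: pow2_pair_def)

lemma is_ideal_Fin_times_Fin: "is_ideal Fin_times_Fin"
  unfolding is_ideal_def
proof (intro conjI ballI allI impI)
  show "Fin_times_Fin \<noteq> {}"
    unfolding Fin_times_Fin_def by (auto intro!: exI[of _ "{}"])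
  show "Fin_times_Fin \<subseteq> Pow NN"
    unfolding Fin_times_Fin_def by blast
  show "B \<in> Fin_times_Fin" if "A \<in> Fin_times_Fin" "B \<subseteq> A" for A B
    using that unfolding Fin_times_Fin_def
    by (auto elim!: eventually_mono intro: finite_subset[rotated])
  show "A \<union> B \<in> Fin_times_Fin" if "A \<in> Fin_times_Fin" "B \<in> Fin_times_Fin" for A B
    using that unfolding Fin_times_Fin_def
    by (auto simp: Collect_disj_eq eventually_conj_iff)
  show "A \<in> Fin_times_Fin" if "A \<subseteq> NN \<and> finite A" for A
  proof -
    have "finite {m. pow2_pair k m \<in> A}" for k
      using finite_vimageI[of A "pow2_pair k"] that by (auto simp: vimage_def inj_on_def)
    then show ?thesis
      using that unfolding Fin_times_Fin_def by simp
  qed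
  \<comment> \<open>Every column lies wholly in \<open>NN\<close>, so none of the index sets is
    finite.\<close>
  show "NN \<notin> Fin_times_Fin"
    unfolding Fin_times_Fin_def by simp
qed

text \<open>The columns are the witnessing family: each is in the ideal, but a set that meets all of
  them in finite sets is itself in the ideal, so no positive set can do so.\<close>

lemma not_weak_P_ideal_Fin_times_Fin: "\<not> weak_P_ideal Fin_times_Fin"
proof
  assume "weak_P_ideal Fin_times_Fin"
  moreover have "range (\<lambda>k. range (pow2_pair k)) \<subseteq> Fin_times_Fin"
  proof (clarify)
    fix k
    \<comment> \<open>Distinct columns are disjoint, so beyond \<open>k\<close> these index sets are
      empty.\<close>
    have "finite {m. pow2_pair j m \<in> range (pow2_pair k)}" if "j > k" for j
      using that by (simp add: image_iff)
    then show "range (pow2_pair k) \<in> Fin_times_Fin"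
      unfolding Fin_times_Fin_def
      by (auto simp: intro: eventually_mono[OF eventually_gt_at_top[of k]])
  qed
  ultimately obtain B where B: "B \<in> coideal Fin_times_Fin"
    "\<And>k. finite (B \<inter> range (pow2_pair k))"
    unfolding weak_P_ideal_def by (auto dest!: spec[of _ "range (\<lambda>k. range (pow2_pair k))"])
  have "finite {m. pow2_pair k m \<in> B}" for k
  proof -
    have "finite (pow2_pair k -` (B \<inter> range (pow2_pair k)))"
      by (rule finite_vimageI[OF B(2)]) (simp add: inj_on_def)
    then show ?thesis
      by (simp add: vimage_def)
  qed
  then show False
    using B(1) unfolding coideal_def Fin_times_Fin_def by simp
qed

lemma Fin_times_Fin_dual_summable: "dual_filter Fin_times_Fin \<inter> summable_ideal \<noteq> {}"
proof -
  let ?S = "range (\<lambda>k. 2 ^ k) :: nat set"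
  \<comment> \<open>All values of \<open>pow2_pair\<close> are powers of two, so the complement of
    \<open>?S\<close> misses every column.\<close>
  have "{m. pow2_pair k m \<in> NN - ?S} = {}" for k
    by (auto simp: pow2_pair_def)
  then have "NN - ?S \<in> Fin_times_Fin"
    unfolding Fin_times_Fin_def by (simp only: mem_Collect_eq) auto
  then have "?S \<in> dual_filter Fin_times_Fin"
    unfolding dual_filter_iff[OF is_ideal_Fin_times_Fin] by auto
  then show ?thesis
    using powers_of_two_summable by blast
qed

theorem proposition4p2:
  fixes I :: "nat set set"
  assumes "is_ideal I"
  shows
   "(coideal I \<inter> summable_ideal \<noteq> {} \<and> dual_filter I \<inter> summable_ideal = {} \<longrightarrow>
       \<not> AOS I \<subseteq> AOS_plus I \<and> \<not> AOS_star I \<subseteq> AOS_plus I) \<and>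
    ((\<forall>J. is_ideal J \<and> J \<subset> summable_ideal \<longrightarrow>
        coideal J \<inter> summable_ideal \<noteq> {} \<and> dual_filter J \<inter> summable_ideal = {}) \<and>
     is_ideal Fin \<and> Fin \<subset> summable_ideal) \<and>
    (\<not> weak_P_ideal I \<and> dual_filter I \<inter> summable_ideal \<noteq> {} \<longrightarrow> \<not> AOS_plus I \<subseteq> AOS I) \<and>
    (\<not> P_ideal I \<and> dual_filter I \<inter> summable_ideal \<noteq> {} \<longrightarrow> \<not> AOS_star I \<subseteq> AOS I) \<and>
    (\<exists>J. is_ideal J \<and> \<not> weak_P_ideal J \<and> \<not> P_ideal J \<and>
        dual_filter J \<inter> summable_ideal \<noteq> {})"
proof (intro conjI)
  show "coideal I \<inter> summable_ideal \<noteq> {} \<and> dual_filter I \<inter> summable_ideal = {} \<longrightarrow>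
      \<not> AOS I \<subseteq> AOS_plus I \<and> \<not> AOS_star I \<subseteq> AOS_plus I"
    using positive_summable_set_counterexample[OF assms] by blast
  show "\<forall>J. is_ideal J \<and> J \<subset> summable_ideal \<longrightarrow>
      coideal J \<inter> summable_ideal \<noteq> {} \<and> dual_filter J \<inter> summable_ideal = {}"
    using proper_subideal_of_summable by blast
  show "\<not> weak_P_ideal I \<and> dual_filter I \<inter> summable_ideal \<noteq> {} \<longrightarrow> \<not> AOS_plus I \<subseteq> AOS I"
    using not_weak_P_ideal_counterexample[OF assms] by blast
  show "\<not> P_ideal I \<and> dual_filter I \<inter> summable_ideal \<noteq> {} \<longrightarrow> \<not> AOS_star I \<subseteq> AOS I"
    using not_P_ideal_counterexample[OF assms] by blast
  show "\<exists>J. is_ideal J \<and> \<not> weak_P_ideal J \<and> \<not> P_ideal J \<and>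
      dual_filter J \<inter> summable_ideal \<noteq> {}"
  proof (intro exI conjI)
    show "\<not> P_ideal Fin_times_Fin"
      using not_weak_P_ideal_Fin_times_Fin weak_P_ideal_if_P_ideal by blast
  qed (rule is_ideal_Fin_times_Fin not_weak_P_ideal_Fin_times_Fin Fin_times_Fin_dual_summable)+
qed (rule is_ideal_Fin Fin_psubset_summable_ideal)+

end
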